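(* Let $U$ be a subset of $F_{USCG}(\mathbb{R}^m)$. Then $U$ is a totally bounded set in $(F_{USCG}(\mathbb{R}^m),H_{\rm end})$ if and only if, for each $\alpha\in(0,1]$, $U(\alpha):=\bigcup_{u\in U}[u]_\alpha$ is a bounded set in $\mathbb{R}^m$.
   Context: A fuzzy set on $\mathbb{R}^m$ is a function $u:\mathbb{R}^m\to[0,1]$. For $\alpha\in(0,1]$, $[u]_\alpha=\{x:u(x)\ge\alpha\}$. $F_{USCG}(\mathbb{R}^m)$ is the set of all upper semi-continuous fuzzy sets $u$ on $\mathbb{R}^m$ with $[u]_\alpha$ bounded for each $\alpha\in(0,1]$ (cuts may be empty). The endograph of $u$ is ${\rm end}\,u=\{(x,t)\in\mathbb{R}^m\times[0,1]:u(x)\ge t\}$, and the endograph metric is $H_{\rm end}(u,v)=H({\rm end}\,u,{\rm end}\,v)$, where $H(A,B)=\max\{\sup_{a\in A}\inf_{b\in B}d(a,b),\ \sup_{b\in B}\inf_{a\in A}d(a,b)\}$ is the Hausdorff metric on nonempty closed sets ($d$ Euclidean). *)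

theory Defs
  imports "HOL-Analysis.Analysis"
begin

definition upper_semicontinuous :: "('a::topological_space \<Rightarrow> real) \<Rightarrow> bool" where
  "upper_semicontinuous f \<longleftrightarrow> (\<forall>x c. f x < c \<longrightarrow> (\<forall>\<^sub>F y in nhds x. f y < c))"

definition fuzzy_set :: "('a \<Rightarrow> real) \<Rightarrow> bool" where
  "fuzzy_set u \<longleftrightarrow> (\<forall>x. u x \<in> {0..1})"

definition alpha_cut :: "('a \<Rightarrow> real) \<Rightarrow> real \<Rightarrow> 'a set" where
  "alpha_cut u \<alpha> = {x. u x \<ge> \<alpha>}"

definition F_USCG :: "(real ^ 'm \<Rightarrow> real) set" where
  "F_USCG = {u. fuzzy_set u \<and> upper_semicontinuous u \<and> (\<forall>\<alpha>\<in>{0<..1}. bounded (alpha_cut u \<alpha>))}"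

definition endograph :: "('a \<Rightarrow> real) \<Rightarrow> ('a \<times> real) set" where
  "endograph u = {(x, t). t \<in> {0..1} \<and> u x \<ge> t}"

text \<open>Values are extended so that suprema and infima never degenerate.\<close>

definition hausdorff_dist :: "'a::metric_space set \<Rightarrow> 'a set \<Rightarrow> ennreal" where
  "hausdorff_dist A B =
     max (SUP a\<in>A. INF b\<in>B. ennreal (dist a b)) (SUP b\<in>B. INF a\<in>A. ennreal (dist a b))"

text \<open>The library metric on \<open>(real ^ 'm) \<times> real\<close> is the Euclidean one (\<open>dist_prod_def\<close>,
  \<open>dist_vec_def\<close>). Endographs of fuzzy sets are at Hausdorff distance at most 1
  (\<open>hausdorff_dist_endograph_le\<close>), so nothing is lost by \<open>enn2real\<close> there.\<close>

definition H_end :: "(real ^ 'm \<Rightarrow> real) \<Rightarrow> (real ^ 'm \<Rightarrow> real) \<Rightarrow> real" where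
  "H_end u v = enn2real (hausdorff_dist (endograph u) (endograph v))"

lemma hausdorff_dist_commute: "hausdorff_dist A B = hausdorff_dist B A"
  by (simp add: hausdorff_dist_def max.commute dist_commute)

lemma INF_add_left_ennreal:
  fixes c :: ennreal
  assumes "I \<noteq> {}"
  shows "(INF i\<in>I. c + f i) = c + (INF i\<in>I. f i)"
  using continuous_at_Inf_mono[of "\<lambda>x. c + x" "f ` I"] assms
    continuous_add[of "at_right (Inf (f ` I))" "\<lambda>x. c" "\<lambda>x. x"]
  by (auto simp: mono_def image_comp intro!: add_left_mono)

lemma hausdorff_semidist_triangle:
  fixes A B C :: "'a::metric_space set"
  shows "(SUP a\<in>A. INF c\<in>C. ennreal (dist a c)) \<le>
    (SUP a\<in>A. INF b\<in>B. ennreal (dist a b)) + (SUP b\<in>B. INF c\<in>C. ennreal (dist b c))"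
    (is "_ \<le> ?P + ?Q")
proof (rule SUP_least)
  fix a assume a: "a \<in> A"
  have "(INF c\<in>C. ennreal (dist a c)) \<le> (INF b\<in>B. ennreal (dist a b)) + ?Q"
  proof (cases "B = {}")
    case False
    have "(INF c\<in>C. ennreal (dist a c)) \<le> ennreal (dist a b) + ?Q" if b: "b \<in> B" for b
    proof -
      have "(INF c\<in>C. ennreal (dist a c)) \<le> (INF c\<in>C. ennreal (dist a b) + ennreal (dist b c))"
        by (intro INF_mono) (metis dist_triangle ennreal_leI ennreal_plus zero_le_dist)
      also have "\<dots> = ennreal (dist a b) + (INF c\<in>C. ennreal (dist b c))"
        by (cases "C = {}") (simp_all add: INF_add_left_ennreal)
      also have "\<dots> \<le> ennreal (dist a b) + ?Q"
        by (intro add_left_mono SUP_upper b)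
      finally show ?thesis .
    qed
    then have "(INF c\<in>C. ennreal (dist a c)) \<le> (INF b\<in>B. ennreal (dist a b) + ?Q)"
      by (intro INF_greatest)
    also have "\<dots> = (INF b\<in>B. ennreal (dist a b)) + ?Q"
      using False by (simp add: INF_add_left_ennreal add.commute[of _ ?Q])
    finally show ?thesis .
  qed simp
  also have "\<dots> \<le> ?P + ?Q"
    by (intro add_right_mono SUP_upper a)
  finally show "(INF c\<in>C. ennreal (dist a c)) \<le> ?P + ?Q" .
qed

lemma hausdorff_dist_triangle:
  "hausdorff_dist A C \<le> hausdorff_dist A B + hausdorff_dist B C"
proof -
  have "(SUP a\<in>A. INF c\<in>C. ennreal (dist a c)) \<le> hausdorff_dist A B + hausdorff_dist B C"
    by (rule order_trans[OF hausdorff_semidist_triangle[where B = B]])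
      (auto simp: hausdorff_dist_def intro!: add_mono)
  moreover have "(SUP c\<in>C. INF a\<in>A. ennreal (dist a c)) \<le> hausdorff_dist A B + hausdorff_dist B C"
  proof -
    have "(SUP c\<in>C. INF a\<in>A. ennreal (dist c a)) \<le>
        (SUP c\<in>C. INF b\<in>B. ennreal (dist c b)) + (SUP b\<in>B. INF a\<in>A. ennreal (dist b a))"
      by (rule hausdorff_semidist_triangle)
    also have "\<dots> \<le> hausdorff_dist B C + hausdorff_dist A B"
      by (intro add_mono) (auto simp: hausdorff_dist_def dist_commute)
    finally show ?thesis by (simp add: dist_commute add.commute)
  qed
  ultimately show ?thesis
    by (subst (1) hausdorff_dist_def) simp
qed

lemma hausdorff_dist_eq_0D:
  assumes "hausdorff_dist A B = 0" "closed B"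
  shows "A \<subseteq> B"
proof
  fix a assume a: "a \<in> A"
  have "(INF b\<in>B. ennreal (dist a b)) \<le> hausdorff_dist A B"
    unfolding hausdorff_dist_def by (intro max.coboundedI1 SUP_upper a)
  then have z: "(INF b\<in>B. ennreal (dist a b)) = 0" using assms by simp
  have "a \<in> closure B"
    unfolding closure_approachable
  proof (intro allI impI)
    fix e :: real assume "e > 0"
    then have "(INF b\<in>B. ennreal (dist a b)) < ennreal e" by (simp add: z)
    then obtain b where "b \<in> B" "ennreal (dist a b) < ennreal e" by (auto simp: INF_less_iff)
    then show "\<exists>y\<in>B. dist y a < e" by (auto simp: ennreal_less_iff dist_commute)
  qed
  then show "a \<in> B" using assms by simp
qed

lemma closed_endograph:
  fixes u :: "'a::topological_space \<Rightarrow> real"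
  assumes "upper_semicontinuous u"
  shows "closed (endograph u)"
proof -
  have "open {p. u (fst p) < snd p}"
    unfolding open_prod_def
  proof clarsimp
    fix x t assume "u x < t"
    then obtain c where c: "u x < c" "c < t" using dense by blast
    then have "\<forall>\<^sub>F y in nhds x. u y < c" using assms by (auto simp: upper_semicontinuous_def)
    then obtain S where "open S" "x \<in> S" "\<forall>y\<in>S. u y < c" by (auto simp: eventually_nhds)
    then show "\<exists>A. open A \<and> (\<exists>B. open B \<and> x \<in> A \<and> t \<in> B \<and> A \<times> B \<subseteq> {p. u (fst p) < snd p})"
      using c by (intro exI[of _ S] conjI exI[of _ "{c<..}"]) force+
  qed
  then have "closed (- {p. u (fst p) < snd p})" by (simp add: closed_def)
  moreover have "closed (UNIV \<times> {0..1::real} :: ('a \<times> real) set)" by (intro closed_Times) auto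
  moreover have "endograph u = - {p. u (fst p) < snd p} \<inter> UNIV \<times> {0..1}"
    by (auto simp: endograph_def)
  ultimately show ?thesis by (metis closed_Int)
qed

lemma endograph_subset_iff:
  assumes "fuzzy_set u"
  shows "endograph u \<subseteq> endograph v \<longleftrightarrow> (\<forall>x. u x \<le> v x)"
proof
  assume *: "endograph u \<subseteq> endograph v"
  have "(x, u x) \<in> endograph u" for x using assms by (auto simp: endograph_def fuzzy_set_def)
  with * show "\<forall>x. u x \<le> v x" by (force simp: endograph_def)
qed (auto simp: endograph_def intro: order_trans)

lemma hausdorff_dist_endograph_le:
  fixes u v :: "'a::metric_space \<Rightarrow> real"
  assumes "fuzzy_set u" "fuzzy_set v"
  shows "hausdorff_dist (endograph u) (endograph v) \<le> 1"
proof -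
  have *: "(SUP a\<in>endograph u. INF b\<in>endograph v. ennreal (dist a b)) \<le> 1"
    if "fuzzy_set v" for u v :: "'a \<Rightarrow> real"
  proof (rule SUP_least)
    fix p assume p: "p \<in> endograph u"
    have "(fst p, 0) \<in> endograph v" using that by (auto simp: endograph_def fuzzy_set_def)
    moreover have "dist p (fst p, 0) \<le> 1" using p
      by (cases p) (auto simp: dist_Pair_Pair endograph_def)
    ultimately show "(INF b\<in>endograph v. ennreal (dist p b)) \<le> 1"
      by (intro INF_lower2[of "(fst p, 0)"]) (auto simp: ennreal_le_1)
  qed
  show ?thesis
    using *[OF assms(2), of u] *[OF assms(1), of v] by (simp add: hausdorff_dist_def dist_commute)
qed

text \<open>Required for \<open>Metric_space.mtotally_bounded\<close> to have its intended meaning.\<close>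

lemma Metric_space_F_USCG: "Metric_space (F_USCG :: (real ^ 'm \<Rightarrow> real) set) H_end"
proof
  fix u v w :: "real ^ 'm \<Rightarrow> real"
  show "0 \<le> H_end u v" by (simp add: H_end_def)
  show "H_end u v = H_end v u" by (simp add: H_end_def hausdorff_dist_commute)
  have fin: "hausdorff_dist (endograph u) (endograph v) < top"
    if "u \<in> F_USCG" "v \<in> F_USCG" for u v :: "real ^ 'm \<Rightarrow> real"
    using hausdorff_dist_endograph_le[of u v] that
    by (auto simp: F_USCG_def intro: le_less_trans)
  show "H_end u v = 0 \<longleftrightarrow> u = v" if uv: "u \<in> F_USCG" "v \<in> F_USCG"
  proof
    assume "H_end u v = 0"
    then have 0: "hausdorff_dist (endograph u) (endograph v) = 0"
      using fin[OF uv] by (auto simp: H_end_def enn2real_eq_0_iff)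
    then have "endograph u \<subseteq> endograph v" "endograph v \<subseteq> endograph u"
      using uv hausdorff_dist_eq_0D[OF 0]
        hausdorff_dist_eq_0D[OF 0[unfolded hausdorff_dist_commute[of "endograph u"]]]
      by (auto simp: F_USCG_def closed_endograph)
    then show "u = v"
      using uv endograph_subset_iff[of u v] endograph_subset_iff[of v u]
      by (intro ext antisym) (auto simp: F_USCG_def)
  next
    assume "u = v"
    have "(SUP a\<in>A. INF b\<in>A. ennreal (dist a b)) \<le> 0" for A :: "((real ^ 'm) \<times> real) set"
    proof (rule SUP_least)
      fix a assume "a \<in> A"
      then show "(INF b\<in>A. ennreal (dist a b)) \<le> 0" by (intro INF_lower2[of a]) simp_all
    qed
    then have "hausdorff_dist A A = 0" for A :: "((real ^ 'm) \<times> real) set"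
      by (simp add: hausdorff_dist_def dist_commute)
    then show "H_end u v = 0" using \<open>u = v\<close> by (simp add: H_end_def)
  qed
  show "H_end u w \<le> H_end u v + H_end v w"
    if "u \<in> F_USCG" "v \<in> F_USCG" "w \<in> F_USCG"
    using hausdorff_dist_triangle[of "endograph u" "endograph w" "endograph v"] fin that
    by (simp add: H_end_def enn2real_plus[symmetric] enn2real_mono)
qed

end

theory Submission
  imports Defs
begin

text \<open>
  Both directions rest on reading \<open>H_end u v < e\<close> pointwise: every point of one endograph has
  a point of the other within distance \<open>e\<close> (lemmas \<open>H_end_less_imp_close\<close> and
  \<open>H_end_le_if_close\<close>).

  If \<open>U\<close> is totally bounded, take a finite \<open>\<alpha>/2\<close>-net \<open>K\<close>. A point \<open>(x, \<alpha>)\<close> of an endograph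
  of \<open>U\<close> is then \<open>\<alpha>/2\<close>-close to a point of the endograph of some \<open>k \<in> K\<close>, and the height of that
  point is still above \<open>\<alpha>/2\<close>. So the \<open>\<alpha>\<close>-cuts of all members of \<open>U\<close> stay within distance \<open>\<alpha>/2\<close> of
  the finitely many bounded cuts \<open>alpha_cut k (\<alpha>/2)\<close>.

  Conversely, fix \<open>\<delta> > 0\<close>. The part of an endograph below height \<open>\<delta>\<close> carries no information at
  scale \<open>\<delta>\<close>, since each endograph contains the whole hyperplane of height \<open>0\<close>. The parts above height
  \<open>\<delta>\<close> all lie in the single bounded set \<open>(\<Union>u\<in>U. alpha_cut u \<delta>) \<times> {0..1}\<close>, which finitely many
  \<open>\<delta>\<close>-balls cover. Two members of \<open>U\<close> whose endographs meet the same balls are therefore within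
  \<open>2\<delta>\<close> of each other (lemma \<open>endograph_close_if_same_trace\<close>). Only finitely many collections of balls can occur, and
  one member of \<open>U\<close> for each collection that does occur gives a finite net.
\<close>

text \<open>The hypotheses serve to make the extended Hausdorff distance finite: \<open>enn2real\<close> would turn
  an infinite distance into \<open>0\<close>.\<close>

lemma H_end_less_imp_close:
  fixes u v :: "real ^ 'm \<Rightarrow> real"
  assumes "fuzzy_set u" "fuzzy_set v" "H_end u v < e" "p \<in> endograph u"
  obtains q where "q \<in> endograph v" "dist p q < e"
proof -
  have e: "0 < e"
    using assms(3) by (auto simp: H_end_def intro: le_less_trans[OF enn2real_nonneg])
  have "hausdorff_dist (endograph u) (endograph v) < top"
    using hausdorff_dist_endograph_le[OF assms(1,2)] by (auto intro: le_less_trans)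
  then have "hausdorff_dist (endograph u) (endograph v) = ennreal (H_end u v)"
    by (simp add: H_end_def)
  also have "\<dots> < ennreal e"
    using e assms(3) by (rule ennreal_lessI)
  finally have "hausdorff_dist (endograph u) (endograph v) < ennreal e" .
  moreover have "(INF q\<in>endograph v. ennreal (dist p q)) \<le> hausdorff_dist (endograph u) (endograph v)"
    unfolding hausdorff_dist_def by (intro max.coboundedI1 SUP_upper assms(4))
  ultimately have "(INF q\<in>endograph v. ennreal (dist p q)) < ennreal e"
    by (rule le_less_trans[rotated])
  then show ?thesis
    using that by (auto simp: INF_less_iff ennreal_less_iff)
qed

lemma H_end_le_if_close:
  fixes u v :: "real ^ 'm \<Rightarrow> real"
  assumes "0 \<le> e"
    and uv: "\<And>p. p \<in> endograph u \<Longrightarrow> \<exists>q\<in>endograph v. dist p q \<le> e"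
    and vu: "\<And>p. p \<in> endograph v \<Longrightarrow> \<exists>q\<in>endograph u. dist p q \<le> e"
  shows "H_end u v \<le> e"
proof -
  have "(SUP a\<in>A. INF b\<in>B. ennreal (dist a b)) \<le> ennreal e"
    if "\<And>a. a \<in> A \<Longrightarrow> \<exists>b\<in>B. dist a b \<le> e" for A B :: "((real ^ 'm) \<times> real) set"
    using that by (intro SUP_least) (meson INF_lower2 ennreal_leI)
  from this[OF uv] this[OF vu]
  have "hausdorff_dist (endograph u) (endograph v) \<le> ennreal e"
    by (simp add: hausdorff_dist_def dist_commute)
  then show ?thesis
    using assms(1) by (simp add: H_end_def enn2real_leI)
qed

lemma bounded_imp_finite_ball_cover:
  fixes S :: "'a::heine_borel set"
  assumes "bounded S" "0 < e"
  obtains N where "finite N" "S \<subseteq> (\<Union>n\<in>N. ball n e)"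
proof -
  have "compact (closure S)"
    using assms(1) by (simp add: compact_closure)
  then obtain N where "finite N" "closure S \<subseteq> (\<Union>n\<in>N. ball n e)"
    using assms(2) unfolding compact_eq_totally_bounded by blast
  then show ?thesis
    using that closure_subset by blast
qed

text \<open>A low point of the endograph of \<open>u\<close> is matched by dropping to height \<open>0\<close>. A high point lies
  in the covered region, hence in a ball that the endograph of \<open>v\<close> meets too.\<close>

lemma endograph_close_if_same_trace:
  fixes u v :: "real ^ 'm \<Rightarrow> real"
  assumes v: "fuzzy_set v" and "0 < \<delta>"
    and cover: "alpha_cut u \<delta> \<times> {0..1} \<subseteq> (\<Union>n\<in>N. ball n \<delta>)"
    and trace: "{n\<in>N. ball n \<delta> \<inter> endograph u \<noteq> {}} \<subseteq> {n\<in>N. ball n \<delta> \<inter> endograph v \<noteq> {}}"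
    and p: "p \<in> endograph u"
  shows "\<exists>q\<in>endograph v. dist p q \<le> 2 * \<delta>"
proof (cases "snd p \<le> \<delta>")
  case True
  have "(fst p, 0) \<in> endograph v"
    using v by (auto simp: endograph_def fuzzy_set_def)
  moreover have "dist p (fst p, 0) \<le> 2 * \<delta>"
    using True p \<open>0 < \<delta>\<close> by (cases p) (auto simp: dist_Pair_Pair endograph_def)
  ultimately show ?thesis ..
next
  case False
  then have "p \<in> alpha_cut u \<delta> \<times> {0..1}"
    using p by (auto simp: endograph_def alpha_cut_def)
  with cover obtain n where n: "n \<in> N" "p \<in> ball n \<delta>"
    by blast
  with p trace obtain q where q: "q \<in> ball n \<delta>" "q \<in> endograph v"
    by blast
  have "dist p q \<le> dist n p + dist n q"
    by (metis dist_commute dist_triangle)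
  then show ?thesis
    using n q by (intro bexI[of _ q]) auto
qed

theorem theorem7p3:
  fixes U :: "(real ^ 'm \<Rightarrow> real) set"
  assumes "U \<subseteq> F_USCG"
  shows "Metric_space.mtotally_bounded F_USCG H_end U \<longleftrightarrow>
    (\<forall>\<alpha>\<in>{0<..1}. bounded (\<Union>u\<in>U. alpha_cut u \<alpha>))"
proof -
  interpret Metric_space "F_USCG :: (real ^ 'm \<Rightarrow> real) set" H_end
    by (rule Metric_space_F_USCG)
  have fuzzy: "fuzzy_set u" if "u \<in> U" for u
    using assms that by (auto simp: F_USCG_def)
  show ?thesis
  proof
    assume tb: "mtotally_bounded U"
    show "\<forall>\<alpha>\<in>{0<..1}. bounded (\<Union>u\<in>U. alpha_cut u \<alpha>)"
    proof
      fix \<alpha> :: real assume \<alpha>: "\<alpha> \<in> {0<..1}"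
      then have "\<alpha> / 2 > 0" by simp
      with tb obtain K where K: "finite K" "K \<subseteq> U" "U \<subseteq> (\<Union>k\<in>K. mball k (\<alpha> / 2))"
        unfolding mtotally_bounded_def by meson
      have "bounded (\<Union>k\<in>K. alpha_cut k (\<alpha> / 2))"
        using K assms \<alpha> by (intro bounded_UN) (auto simp: F_USCG_def)
      then obtain r where r: "(\<Union>k\<in>K. alpha_cut k (\<alpha> / 2)) \<subseteq> cball 0 r"
        by (auto simp: bounded_iff subset_iff)
      have "x \<in> cball 0 (r + \<alpha> / 2)" if u: "u \<in> U" and x: "x \<in> alpha_cut u \<alpha>" for u x
      proof -
        from u K(3) obtain k where k: "k \<in> K" and "u \<in> mball k (\<alpha> / 2)"
          by blast
        then have near: "H_end u k < \<alpha> / 2"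
          by (simp add: commute[of u k])
        have "(x, \<alpha>) \<in> endograph u"
          using x \<alpha> by (auto simp: endograph_def alpha_cut_def)
        then obtain q where q: "q \<in> endograph k" "dist (x, \<alpha>) q < \<alpha> / 2"
          using H_end_less_imp_close[OF fuzzy[OF u] fuzzy near] k K(2) by blast
        have "dist x (fst q) < \<alpha> / 2" "dist \<alpha> (snd q) < \<alpha> / 2"
          using q(2) dist_fst_le[of "(x, \<alpha>)" q] dist_snd_le[of "(x, \<alpha>)" q] by auto
        moreover from this(2) have "\<alpha> / 2 \<le> snd q"
          unfolding dist_real_def by linarith
        then have "fst q \<in> alpha_cut k (\<alpha> / 2)"
          using q(1) by (auto simp: endograph_def alpha_cut_def)
        then have "norm (fst q) \<le> r"
          using r k by auto
        ultimately show ?thesis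
          using norm_triangle_sub[of x "fst q"] by (simp add: dist_norm)
      qed
      then have "(\<Union>u\<in>U. alpha_cut u \<alpha>) \<subseteq> cball 0 (r + \<alpha> / 2)"
        by blast
      then show "bounded (\<Union>u\<in>U. alpha_cut u \<alpha>)"
        using bounded_subset bounded_cball by blast
    qed
  next
    assume bd: "\<forall>\<alpha>\<in>{0<..1}. bounded (\<Union>u\<in>U. alpha_cut u \<alpha>)"
    show "mtotally_bounded U"
      unfolding mtotally_bounded_def
    proof (intro allI impI)
      fix \<epsilon> :: real assume "\<epsilon> > 0"
      \<comment> \<open>The factor 3 makes \<open>2 * \<delta> < \<epsilon>\<close> strict; the cap at 1 makes \<open>\<delta>\<close> an admissible cut level.\<close>
      define \<delta> where "\<delta> = min \<epsilon> 1 / 3"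
      have \<delta>: "0 < \<delta>" "\<delta> \<le> 1" "2 * \<delta> < \<epsilon>"
        using \<open>\<epsilon> > 0\<close> by (auto simp: \<delta>_def min_def)
      have "bounded ((\<Union>u\<in>U. alpha_cut u \<delta>) \<times> {0..1::real})"
        using bd \<delta> by (intro bounded_Times) auto
      then obtain N where N: "finite N"
        "(\<Union>u\<in>U. alpha_cut u \<delta>) \<times> {0..1::real} \<subseteq> (\<Union>n\<in>N. ball n \<delta>)"
        using \<delta>(1) by (rule bounded_imp_finite_ball_cover)
      define trace where "trace u = {n\<in>N. ball n \<delta> \<inter> endograph u \<noteq> {}}" for u
      have "finite (trace ` U)"
        by (rule finite_subset[of _ "Pow N"]) (auto simp: trace_def N(1))
      then obtain K where K: "K \<subseteq> U" "finite K" "trace ` U = trace ` K"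
        using finite_subset_image[of "trace ` U" trace U] by auto
      have close: "\<exists>q\<in>endograph v. dist p q \<le> 2 * \<delta>"
        if "u \<in> U" "v \<in> U" "trace u = trace v" "p \<in> endograph u" for u v p
        using that N(2) \<delta>(1) fuzzy[of v]
        by (intro endograph_close_if_same_trace[of v \<delta> u N]) (auto simp: trace_def)
      have "u \<in> (\<Union>k\<in>K. mball k \<epsilon>)" if u: "u \<in> U" for u
      proof -
        from u K(3) obtain k where k: "k \<in> K" "trace u = trace k"
          by blast
        have "H_end k u \<le> 2 * \<delta>"
          using \<delta> u k K(1) by (intro H_end_le_if_close close) auto
        then show ?thesis
          using \<delta>(3) u k(1) K(1) assms by (auto intro!: bexI[of _ k])
      qed
      then show "\<exists>K. finite K \<and> K \<subseteq> U \<and> U \<subseteq> (\<Union>k\<in>K. mball k \<epsilon>)"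
        using K by blast
    qed
  qed
qed

end
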